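(* Let $M_1$, $M_2$, $M_3$ be manifolds-with-boundary with free circle actions near their boundaries, and let $\psi_1 \colon M_1\to M_2$ and $\psi_2 \colon M_2\to M_3$ be equivariant transverse maps. Then $(\psi_2\circ\psi_1)_{\mathrm{cut}} = (\psi_2)_{\mathrm{cut}}\circ(\psi_1)_{\mathrm{cut}}$.
   Context: Manifolds, with or without boundary, are smooth, Hausdorff and second countable. For a manifold-with-boundary $M$, $\mathring{M}$ denotes the interior and $\partial M$ the boundary. "A free circle action near the boundary" means a smooth free action of $S^1$ on an open neighbourhood $U_M$ of $\partial M$ in $M$; necessarily $\partial M$ is $S^1$-invariant. Cut space: let $\sim$ be the equivalence relation on $M$ in which distinct points are equivalent iff they both lie in $\partial M$ and lie in the same $S^1$-orbit. $M_{\mathrm{cut}} := M/{\sim}$ with the quotient topology; $c_M \colon M \to M_{\mathrm{cut}}$ is the quotient map. An invariant boundary defining function on $M$ is a smooth $f \colon M \to \mathbb{R}_{\ge 0}$ such that $f^{-1}(0)=\partial M$, $df|_{\partial M}$ never vanishes, and $f$ is $S^1$-invariant on some $S^1$-invariant neighbourhood of $\partial M$ in $U_M$. A map $\psi \colon M\to N$ is an equivariant transverse map if: $\psi$ is smooth; for some (hence every) invariant boundary defining function $f_N$ on $N$, the composition $f_N\circ\psi$ is an invariant boundary defining function on $M$; and there is an $S^1$-invariant neighbourhood $V$ of $\partial M$ in $M$, contained in $U_M\cap\psi^{-1}(U_N)$, such that $\psi|_V \colon V\to U_N$ is $S^1$-equivariant. The composition of equivariant transverse maps is an equivariant transverse map.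 For an equivariant transverse map $\psi$, $\psi_{\mathrm{cut}} \colon M_{\mathrm{cut}}\to N_{\mathrm{cut}}$ denotes the unique map with $\psi_{\mathrm{cut}}\circ c_M=c_N\circ\psi$. *)

theory Defs
  imports "HOL-Analysis.Analysis"
begin

section \<open>Smooth functions on subsets of Euclidean space\<close>

text \<open>
  Points of \<open>\<real>\<^sup>n\<close> are the points of the library topology \<open>Euclidean_space n\<close>: functions
  \<open>nat \<Rightarrow> real\<close> vanishing from index \<open>n\<close> on. This keeps the dimension an ordinary natural
  number and allows \<open>n = 0\<close>.
\<close>

primrec Ck_on :: "nat \<Rightarrow> nat \<Rightarrow> (nat \<Rightarrow> real) set \<Rightarrow> ((nat \<Rightarrow> real) \<Rightarrow> real) \<Rightarrow> bool" where
  "Ck_on 0 n W f \<longleftrightarrow> continuous_map (subtopology (Euclidean_space n) W) euclideanreal f"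
| "Ck_on (Suc k) n W f \<longleftrightarrow>
     continuous_map (subtopology (Euclidean_space n) W) euclideanreal f \<and>
     (\<forall>i<n. \<exists>g. (\<forall>x\<in>W. ((\<lambda>t. f (x(i := t))) has_real_derivative g x) (at (x i))) \<and> Ck_on k n W g)"

text \<open>Smoothness on an arbitrary subset of \<open>\<real>\<^sup>n\<close> means local extendability to a smooth function
  on an open set.\<close>

definition smooth_on :: "nat \<Rightarrow> (nat \<Rightarrow> real) set \<Rightarrow> ((nat \<Rightarrow> real) \<Rightarrow> real) \<Rightarrow> bool" where
  "smooth_on n S f \<longleftrightarrow>
     (\<forall>p\<in>S. \<exists>W g. openin (Euclidean_space n) W \<and> p \<in> W \<and> (\<forall>k. Ck_on k n W g) \<and>
                  (\<forall>x\<in>W \<inter> S. g x = f x))"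

section \<open>Manifolds with boundary\<close>

text \<open>For \<open>n = 0\<close> the condition \<open>0 \<le> x 0\<close> is vacuous, so \<open>half_space 0\<close> is a point.\<close>

definition half_space :: "nat \<Rightarrow> (nat \<Rightarrow> real) topology" where
  "half_space n = subtopology (Euclidean_space n) {x. 0 \<le> x 0}"

record 'a manifold =
  mdim :: nat
  mtop :: "'a topology"
  charts :: "('a set \<times> ('a \<Rightarrow> nat \<Rightarrow> real)) set"

text \<open>The atlas is not required to be maximal.\<close>

definition manifold_with_boundary :: "('a, 'm) manifold_scheme \<Rightarrow> bool" where
  "manifold_with_boundary M \<longleftrightarrow>
     Hausdorff_space (mtop M) \<and> second_countable (mtop M) \<and>
     topspace (mtop M) = \<Union> (fst ` charts M) \<and>
     (\<forall>(U, \<phi>)\<in>charts M. openin (mtop M) U \<and> openin (half_space (mdim M)) (\<phi> ` U) \<and>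
        homeomorphic_map (subtopology (mtop M) U)
          (subtopology (half_space (mdim M)) (\<phi> ` U)) \<phi>) \<and>
     (\<forall>(U, \<phi>)\<in>charts M. \<forall>(V, \<eta>)\<in>charts M. \<forall>j<mdim M.
        smooth_on (mdim M) (\<phi> ` (U \<inter> V)) (\<lambda>x. \<eta> (inv_into U \<phi> x) j))"

definition mboundary :: "('a, 'm) manifold_scheme \<Rightarrow> 'a set" where
  "mboundary M = {p. 0 < mdim M \<and> (\<exists>(U, \<phi>)\<in>charts M. p \<in> U \<and> \<phi> p 0 = 0)}"

definition smooth_map ::
    "('a, 'm) manifold_scheme \<Rightarrow> ('b, 'n) manifold_scheme \<Rightarrow> ('a \<Rightarrow> 'b) \<Rightarrow> bool" where
  "smooth_map M N \<psi> \<longleftrightarrow> continuous_map (mtop M) (mtop N) \<psi> \<and>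
     (\<forall>(U, \<phi>)\<in>charts M. \<forall>(V, \<eta>)\<in>charts N. \<forall>j<mdim N.
        smooth_on (mdim M) (\<phi> ` {p \<in> U. \<psi> p \<in> V}) (\<lambda>x. \<eta> (\<psi> (inv_into U \<phi> x)) j))"

definition smooth_fun :: "('a, 'm) manifold_scheme \<Rightarrow> ('a \<Rightarrow> real) \<Rightarrow> bool" where
  "smooth_fun M f \<longleftrightarrow>
     (\<forall>(U, \<phi>)\<in>charts M. smooth_on (mdim M) (\<phi> ` U) (\<lambda>x. f (inv_into U \<phi> x)))"

text \<open>\<open>df\<close> does not vanish at \<open>p\<close>: in a chart around \<open>p\<close>, some partial derivative of \<open>f\<close> at \<open>p\<close> is
  nonzero. At boundary points the derivative in direction 0 is one-sided, which is why it is taken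
  within the part of the coordinate line lying in the image of the chart.\<close>

definition differential_nonzero :: "('a, 'm) manifold_scheme \<Rightarrow> ('a \<Rightarrow> real) \<Rightarrow> 'a \<Rightarrow> bool" where
  "differential_nonzero M f p \<longleftrightarrow>
     (\<exists>(U, \<phi>)\<in>charts M. p \<in> U \<and> (\<exists>i<mdim M. \<exists>D. D \<noteq> 0 \<and>
        ((\<lambda>t. f (inv_into U \<phi> ((\<phi> p)(i := t)))) has_real_derivative D)
          (at (\<phi> p i) within {t. (\<phi> p)(i := t) \<in> \<phi> ` U})))"

definition open_submanifold :: "('a, 'm) manifold_scheme \<Rightarrow> 'a set \<Rightarrow> 'a manifold" where
  "open_submanifold M W =
     \<lparr>mdim = mdim M, mtop = subtopology (mtop M) W, charts = (\<lambda>(U, \<phi>). (U \<inter> W, \<phi>)) ` charts M\<rparr>"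

text \<open>Product of a manifold \<open>M\<close> without boundary and a manifold-with-boundary \<open>N\<close>. The coordinates
  of \<open>N\<close> come first, so that the coordinate with index 0 remains the one constrained by the
  half-space.\<close>

definition prod_manifold ::
    "('a, 'm) manifold_scheme \<Rightarrow> ('b, 'n) manifold_scheme \<Rightarrow> ('a \<times> 'b) manifold" where
  "prod_manifold M N =
     \<lparr>mdim = mdim M + mdim N,
      mtop = prod_topology (mtop M) (mtop N),
      charts = {(U \<times> V, \<lambda>(p, q) i. if i < mdim N then \<eta> q i else \<phi> p (i - mdim N)) |U \<phi> V \<eta>.
                  (U, \<phi>) \<in> charts M \<and> (V, \<eta>) \<in> charts N}\<rparr>"

abbreviation S1 :: "complex set" where
  "S1 \<equiv> sphere 0 1"

text \<open>The chart on the complement of \<open>a\<close> is the inverse of \<open>t \<mapsto> a e\<^sup>i\<^sup>t\<close>, \<open>0 < t < 2\<pi>\<close>.\<close>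

definition circle :: "complex manifold" where
  "circle =
     \<lparr>mdim = 1, mtop = top_of_set S1,
      charts = {(S1 - {a}, \<lambda>z i. if i = 0 then Arg2pi (z / a) else 0) |a. a \<in> S1}\<rparr>"

section \<open>Free circle actions near the boundary\<close>

record 'a circle_manifold = "'a manifold" +
  nbd :: "'a set"
  act :: "complex \<Rightarrow> 'a \<Rightarrow> 'a"

definition boundary_nbhd :: "('a, 'm) manifold_scheme \<Rightarrow> 'a set \<Rightarrow> bool" where
  "boundary_nbhd M V \<longleftrightarrow> V \<subseteq> topspace (mtop M) \<and> (\<exists>W. openin (mtop M) W \<and> mboundary M \<subseteq> W \<and> W \<subseteq> V)"

definition free_circle_action_near_boundary :: "'a circle_manifold \<Rightarrow> bool" where
  "free_circle_action_near_boundary M \<longleftrightarrow>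
     openin (mtop M) (nbd M) \<and> mboundary M \<subseteq> nbd M \<and>
     (\<forall>z\<in>S1. \<forall>x\<in>nbd M. act M z x \<in> nbd M) \<and>
     (\<forall>x\<in>nbd M. act M 1 x = x) \<and>
     (\<forall>z\<in>S1. \<forall>w\<in>S1. \<forall>x\<in>nbd M. act M (z * w) x = act M z (act M w x)) \<and>
     (\<forall>z\<in>S1. \<forall>x\<in>nbd M. act M z x = x \<longrightarrow> z = 1) \<and>
     smooth_map (prod_manifold circle (open_submanifold M (nbd M))) (open_submanifold M (nbd M))
       (\<lambda>(z, x). act M z x)"

definition invariant_boundary_nbhd :: "'a circle_manifold \<Rightarrow> 'a set \<Rightarrow> bool" where
  "invariant_boundary_nbhd M V \<longleftrightarrow>
     boundary_nbhd M V \<and> V \<subseteq> nbd M \<and> (\<forall>z\<in>S1. \<forall>x\<in>V. act M z x \<in> V)"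

definition invariant_boundary_defining :: "'a circle_manifold \<Rightarrow> ('a \<Rightarrow> real) \<Rightarrow> bool" where
  "invariant_boundary_defining M f \<longleftrightarrow>
     smooth_fun M f \<and> (\<forall>x\<in>topspace (mtop M). 0 \<le> f x) \<and>
     {x \<in> topspace (mtop M). f x = 0} = mboundary M \<and>
     (\<forall>p\<in>mboundary M. differential_nonzero M f p) \<and>
     (\<exists>V. invariant_boundary_nbhd M V \<and> (\<forall>z\<in>S1. \<forall>x\<in>V. f (act M z x) = f x))"

definition equivariant_transverse ::
    "'a circle_manifold \<Rightarrow> 'b circle_manifold \<Rightarrow> ('a \<Rightarrow> 'b) \<Rightarrow> bool" where
  "equivariant_transverse M N \<psi> \<longleftrightarrow>
     smooth_map M N \<psi> \<and>
     (\<exists>f. invariant_boundary_defining N f \<and> invariant_boundary_defining M (f \<circ> \<psi>)) \<and>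
     (\<exists>V. invariant_boundary_nbhd M V \<and> (\<forall>x\<in>V. \<psi> x \<in> nbd N) \<and>
          (\<forall>z\<in>S1. \<forall>x\<in>V. \<psi> (act M z x) = act N z (\<psi> x)))"

section \<open>Cut spaces\<close>

definition cut_rel :: "'a circle_manifold \<Rightarrow> 'a rel" where
  "cut_rel M = {(x, y). x \<in> topspace (mtop M) \<and> y \<in> topspace (mtop M) \<and>
     (x = y \<or> x \<in> mboundary M \<and> y \<in> mboundary M \<and> (\<exists>z\<in>S1. y = act M z x))}"

definition cut_proj :: "'a circle_manifold \<Rightarrow> 'a \<Rightarrow> 'a set" where
  "cut_proj M x = cut_rel M `` {x}"

definition cut_space :: "'a circle_manifold \<Rightarrow> 'a set topology" where
  "cut_space M = topology (\<lambda>W. W \<subseteq> topspace (mtop M) // cut_rel M \<and>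
     openin (mtop M) {x \<in> topspace (mtop M). cut_proj M x \<in> W})"

lemma openin_cut_space:
  "openin (cut_space M) W \<longleftrightarrow>
     W \<subseteq> topspace (mtop M) // cut_rel M \<and>
     openin (mtop M) {x \<in> topspace (mtop M). cut_proj M x \<in> W}"
proof -
  have "istopology (\<lambda>W. W \<subseteq> topspace (mtop M) // cut_rel M \<and>
     openin (mtop M) {x \<in> topspace (mtop M). cut_proj M x \<in> W})" (is "istopology ?P")
    unfolding istopology_def
  proof (intro conjI allI impI)
    fix A B assume "?P A" "?P B"
    moreover have "{x \<in> topspace (mtop M). cut_proj M x \<in> A \<inter> B} =
        {x \<in> topspace (mtop M). cut_proj M x \<in> A} \<inter> {x \<in> topspace (mtop M). cut_proj M x \<in> B}"
      by auto
    ultimately show "A \<inter> B \<subseteq> topspace (mtop M) // cut_rel M"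
      "openin (mtop M) {x \<in> topspace (mtop M). cut_proj M x \<in> A \<inter> B}"
      by auto
  next
    fix K assume K: "\<forall>A\<in>K. ?P A"
    have "{x \<in> topspace (mtop M). cut_proj M x \<in> \<Union>K} =
        (\<Union>A\<in>K. {x \<in> topspace (mtop M). cut_proj M x \<in> A})"
      by auto
    then show "\<Union>K \<subseteq> topspace (mtop M) // cut_rel M"
      "openin (mtop M) {x \<in> topspace (mtop M). cut_proj M x \<in> \<Union>K}"
      using K by auto
  qed
  then show ?thesis
    by (simp add: cut_space_def topology_inverse')
qed

lemma topspace_cut_space: "topspace (cut_space M) = topspace (mtop M) // cut_rel M"
proof (rule antisym)
  show "topspace (cut_space M) \<subseteq> topspace (mtop M) // cut_rel M"
    using openin_topspace openin_cut_space by blast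
  have "{x \<in> topspace (mtop M). cut_proj M x \<in> topspace (mtop M) // cut_rel M} = topspace (mtop M)"
    by (auto simp: cut_proj_def intro: quotientI)
  then have "openin (cut_space M) (topspace (mtop M) // cut_rel M)"
    by (simp add: openin_cut_space)
  then show "topspace (mtop M) // cut_rel M \<subseteq> topspace (cut_space M)"
    by (rule openin_subset)
qed

lemma quotient_map_cut_proj: "quotient_map (mtop M) (cut_space M) (cut_proj M)"
  unfolding quotient_map_def topspace_cut_space openin_cut_space
  by (auto simp: cut_proj_def quotient_def)

text \<open>Maps between cut spaces are represented by extensional functions (\<open>undefined\<close> outside
  \<open>M\<^sub>c\<^sub>u\<^sub>t\<close>), which is what makes the induced map unique as a HOL function.\<close>

definition cut_map ::
    "'a circle_manifold \<Rightarrow> 'b circle_manifold \<Rightarrow> ('a \<Rightarrow> 'b) \<Rightarrow> ('a set \<Rightarrow> 'b set)" where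
  "cut_map M N \<psi> =
     (THE g. g \<in> topspace (cut_space M) \<rightarrow>\<^sub>E topspace (cut_space N) \<and>
             (\<forall>x\<in>topspace (mtop M). g (cut_proj M x) = cut_proj N (\<psi> x)))"

end

theory Submission
  imports Defs
begin

text \<open>
  If \<open>f\<close> and \<open>f \<circ> \<psi>\<close> are boundary defining functions, \<open>\<psi>\<close> maps the boundary into the boundary;
  being equivariant near it, \<open>\<psi>\<close> preserves the cut relation and so descends to the cut spaces.
  Both sides of the theorem then satisfy the property that characterises \<open>(\<psi>\<^sub>2 \<circ> \<psi>\<^sub>1)\<^sub>c\<^sub>u\<^sub>t\<close>.
\<close>

lemma cut_rel_boundaryI:
  assumes "x \<in> topspace (mtop M)" and "y \<in> topspace (mtop M)"
    and "x \<in> mboundary M" and "y \<in> mboundary M" and "z \<in> S1" and "y = act M z x"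
  shows "(x, y) \<in> cut_rel M"
  unfolding cut_rel_def using assms by blast

lemma cut_rel_topspace:
  assumes "(x, y) \<in> cut_rel M"
  shows "x \<in> topspace (mtop M)" and "y \<in> topspace (mtop M)"
  using assms by (auto simp: cut_rel_def)

lemma cut_proj_in_cut_space:
  assumes "x \<in> topspace (mtop M)"
  shows "cut_proj M x \<in> topspace (cut_space M)"
  using assms by (simp add: topspace_cut_space cut_proj_def quotientI)

lemma in_cut_spaceE:
  assumes "c \<in> topspace (cut_space M)"
  obtains x where "x \<in> topspace (mtop M)" and "c = cut_proj M x"
  using assms by (auto simp: topspace_cut_space cut_proj_def elim: quotientE)

lemma equivariant_transverse_in_topspace:
  assumes "equivariant_transverse M N \<psi>" and "x \<in> topspace (mtop M)"
  shows "\<psi> x \<in> topspace (mtop N)"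
  using assms by (auto simp: equivariant_transverse_def smooth_map_def continuous_map_def)

text \<open>On the boundary the relation inherits its laws from the action: inverses in
  \<open>S1\<close> give symmetry, products give transitivity. The action laws are available only on
  \<open>nbd M\<close>, which contains the boundary.\<close>

lemma equiv_cut_rel:
  assumes "free_circle_action_near_boundary M"
  shows "equiv (topspace (mtop M)) (cut_rel M)"
proof (rule equivI)
  have sub: "mboundary M \<subseteq> nbd M" and one: "\<And>x. x \<in> nbd M \<Longrightarrow> act M 1 x = x"
    and mult: "\<And>z w x. \<lbrakk>z \<in> S1; w \<in> S1; x \<in> nbd M\<rbrakk> \<Longrightarrow> act M (z * w) x = act M z (act M w x)"
    using assms by (auto simp: free_circle_action_near_boundary_def)
  show "cut_rel M \<subseteq> topspace (mtop M) \<times> topspace (mtop M)" "refl_on (topspace (mtop M)) (cut_rel M)"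
    by (auto simp: cut_rel_def refl_on_def)
  show "sym (cut_rel M)"
  proof (rule symI)
    fix x y assume xy: "(x, y) \<in> cut_rel M"
    then consider "x = y" | z where "x \<in> mboundary M" "y \<in> mboundary M" "z \<in> S1" "y = act M z x"
      unfolding cut_rel_def by blast
    then show "(y, x) \<in> cut_rel M"
    proof cases
      case (2 z)
      have "z \<noteq> 0"
        using 2(3) by auto
      then have z: "inverse z \<in> S1" "inverse z * z = 1"
        using 2(3) by (auto simp: norm_inverse)
      have x: "x \<in> nbd M"
        using 2(1) sub by blast
      \<comment> \<open>Both sides equal \<open>act M (inverse z * z) x\<close>, the action of 1 on
        \<open>x\<close>.\<close>
      have "x = act M (inverse z) y"
        using mult[OF z(1) 2(3) x] one[OF x] z(2) 2(4) by metis
      with cut_rel_topspace[OF xy] 2(1,2) z(1) show ?thesis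
        by (blast intro: cut_rel_boundaryI)
    qed (use xy in simp)
  qed
  show "trans (cut_rel M)"
  proof (rule transI)
    fix x y u assume xy: "(x, y) \<in> cut_rel M" and yu: "(y, u) \<in> cut_rel M"
    then consider "x = y" | "y = u" | z w where "x \<in> mboundary M" "u \<in> mboundary M"
      "z \<in> S1" "w \<in> S1" "y = act M z x" "u = act M w y"
      unfolding cut_rel_def by blast
    then show "(x, u) \<in> cut_rel M"
    proof cases
      case (3 z w)
      \<comment> \<open>The remaining case has two steps along one orbit: first by \<open>z\<close>,
        then by \<open>w\<close>, hence by \<open>w * z\<close>.\<close>
      have "x \<in> nbd M"
        using 3(1) sub by blast
      then have "u = act M (w * z) x"
        using mult 3(3-6) by metis
      moreover have "w * z \<in> S1"
        using 3(3,4) by (simp add: norm_mult)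
      ultimately show ?thesis
        using cut_rel_topspace[OF xy] cut_rel_topspace[OF yu] 3(1,2)
        by (blast intro: cut_rel_boundaryI)
    qed (use xy yu in simp_all)
  qed
qed

lemma equivariant_transverse_cut_rel:
  assumes "equivariant_transverse M N \<psi>" and "(x, y) \<in> cut_rel M"
  shows "(\<psi> x, \<psi> y) \<in> cut_rel N"
proof -
  have top: "\<psi> p \<in> topspace (mtop N)" if "p \<in> topspace (mtop M)" for p
    using equivariant_transverse_in_topspace[OF assms(1) that] .
  obtain f where f: "invariant_boundary_defining N f" "invariant_boundary_defining M (f \<circ> \<psi>)"
    using assms(1) unfolding equivariant_transverse_def by blast
  \<comment> \<open>The boundaries are the zero sets of \<open>f \<circ> \<psi>\<close> and of
    \<open>f\<close>, so a zero of the former is sent to a zero of the latter.\<close>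
  have bd: "\<psi> p \<in> mboundary N" if "p \<in> mboundary M" for p
  proof -
    have "p \<in> topspace (mtop M)" "f (\<psi> p) = 0"
      using f(2) that unfolding invariant_boundary_defining_def by auto
    then show ?thesis
      using f(1) top unfolding invariant_boundary_defining_def by blast
  qed
  obtain V where V: "invariant_boundary_nbhd M V"
      "\<forall>z\<in>S1. \<forall>p\<in>V. \<psi> (act M z p) = act N z (\<psi> p)"
    using assms(1) unfolding equivariant_transverse_def by blast
  have "mboundary M \<subseteq> V"
    using V(1) unfolding invariant_boundary_nbhd_def boundary_nbhd_def by (meson order_trans)
  then have equi: "\<psi> (act M z p) = act N z (\<psi> p)" if "p \<in> mboundary M" "z \<in> S1" for p z
    using V(2) that by blast
  have tops: "\<psi> x \<in> topspace (mtop N)" "\<psi> y \<in> topspace (mtop N)"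
    using cut_rel_topspace[OF assms(2)] top by auto
  consider "x = y" | z where "x \<in> mboundary M" "y \<in> mboundary M" "z \<in> S1" "y = act M z x"
    using assms(2) unfolding cut_rel_def by blast
  then show ?thesis
  proof cases
    case (2 z)
    then have "\<psi> y = act N z (\<psi> x)"
      using equi by blast
    then show ?thesis
      using 2 tops bd by (blast intro: cut_rel_boundaryI)
  qed (use tops in \<open>simp add: cut_rel_def\<close>)
qed

text \<open>Uniqueness half of the definition by \<open>THE\<close>: every point of the cut space is
  a class \<open>cut_proj M x\<close>, so the square fixes the values there, and extensionality
  fixes them elsewhere. Exhibiting one candidate therefore identifies
  \<open>cut_map\<close>.\<close>

lemma cut_map_eqI:
  assumes "g \<in> topspace (cut_space M) \<rightarrow>\<^sub>E topspace (cut_space N)"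
    and "\<And>x. x \<in> topspace (mtop M) \<Longrightarrow> g (cut_proj M x) = cut_proj N (\<psi> x)"
  shows "cut_map M N \<psi> = g"
  unfolding cut_map_def
proof (rule the_equality)
  fix h assume h: "h \<in> topspace (cut_space M) \<rightarrow>\<^sub>E topspace (cut_space N) \<and>
    (\<forall>x\<in>topspace (mtop M). h (cut_proj M x) = cut_proj N (\<psi> x))"
  show "h = g"
  proof (rule PiE_ext)
    fix c assume "c \<in> topspace (cut_space M)"
    then obtain x where "x \<in> topspace (mtop M)" "c = cut_proj M x"
      by (rule in_cut_spaceE)
    then show "h c = g c" using h assms(2) by simp
  qed (use h assms(1) in auto)
qed (use assms in auto)

text \<open>Existence half: without a map satisfying the description, \<open>THE\<close> would carry
  no information. The candidate evaluates \<open>\<psi>\<close> at a chosen representative; the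
  choice is harmless because \<open>\<psi>\<close> preserves the cut relation and related points of
  \<open>N\<close> have equal classes.\<close>

lemma
  assumes "free_circle_action_near_boundary N" and "equivariant_transverse M N \<psi>"
  shows cut_map_funcset: "cut_map M N \<psi> \<in> topspace (cut_space M) \<rightarrow>\<^sub>E topspace (cut_space N)"
    and cut_map_cut_proj: "x \<in> topspace (mtop M) \<Longrightarrow> cut_map M N \<psi> (cut_proj M x) = cut_proj N (\<psi> x)"
proof -
  note eqN = equiv_cut_rel[OF assms(1)]
  \<comment> \<open>\<open>restrict\<close> supplies the value \<open>undefined\<close> off the cut
    space.\<close>
  define g where "g = restrict (\<lambda>c. cut_proj N (\<psi> (SOME y. y \<in> c))) (topspace (cut_space M))"
  have g_proj: "g (cut_proj M x) = cut_proj N (\<psi> x)" if "x \<in> topspace (mtop M)" for x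
  proof -
    \<comment> \<open>The class is nonempty, so \<open>SOME\<close> really picks a member of it, and
      that member is related to \<open>x\<close>.\<close>
    have "x \<in> cut_proj M x"
      using that by (simp add: cut_proj_def cut_rel_def)
    then have "(x, SOME y. y \<in> cut_proj M x) \<in> cut_rel M"
      unfolding cut_proj_def by (metis ImageE singletonD someI_ex)
    then have "(\<psi> x, \<psi> (SOME y. y \<in> cut_proj M x)) \<in> cut_rel N"
      by (rule equivariant_transverse_cut_rel[OF assms(2)])
    then show ?thesis
      using that equiv_class_eq[OF eqN]
      by (auto simp: g_def topspace_cut_space cut_proj_def quotientI)
  qed
  have g_fun: "g \<in> topspace (cut_space M) \<rightarrow>\<^sub>E topspace (cut_space N)"
  proof (rule PiE_I)
    fix c assume "c \<in> topspace (cut_space M)"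
    then obtain x where x: "x \<in> topspace (mtop M)" "c = cut_proj M x"
      by (rule in_cut_spaceE)
    then have "\<psi> x \<in> topspace (mtop N)"
      using equivariant_transverse_in_topspace[OF assms(2)] by blast
    then show "g c \<in> topspace (cut_space N)"
      using x g_proj cut_proj_in_cut_space by simp
  qed (simp add: g_def)
  have "cut_map M N \<psi> = g"
    using g_fun g_proj by (rule cut_map_eqI)
  then show "cut_map M N \<psi> \<in> topspace (cut_space M) \<rightarrow>\<^sub>E topspace (cut_space N)"
    and "x \<in> topspace (mtop M) \<Longrightarrow> cut_map M N \<psi> (cut_proj M x) = cut_proj N (\<psi> x)"
    using g_fun g_proj by auto
qed

theorem lemma2p4:
  fixes M1 :: "'a circle_manifold" and M2 :: "'b circle_manifold" and M3 :: "'c circle_manifold"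
    and \<psi>1 :: "'a \<Rightarrow> 'b" and \<psi>2 :: "'b \<Rightarrow> 'c"
  assumes "manifold_with_boundary M1" and "free_circle_action_near_boundary M1"
    and "manifold_with_boundary M2" and "free_circle_action_near_boundary M2"
    and "manifold_with_boundary M3" and "free_circle_action_near_boundary M3"
    and "equivariant_transverse M1 M2 \<psi>1"
    and "equivariant_transverse M2 M3 \<psi>2"
  shows "cut_map M1 M3 (\<psi>2 \<circ> \<psi>1) =
           compose (topspace (cut_space M1)) (cut_map M2 M3 \<psi>2) (cut_map M1 M2 \<psi>1)"
proof (rule cut_map_eqI)
  \<comment> \<open>By uniqueness it suffices that the composite is extensional with the right range
    and fits the square for \<open>\<psi>2 \<circ> \<psi>1\<close>. Using \<open>compose\<close>
    rather than \<open>\<circ>\<close> keeps it \<open>undefined\<close> off the first cut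
    space.\<close>
  note fun1 = cut_map_funcset[OF assms(4,7)] and fun2 = cut_map_funcset[OF assms(6,8)]
  show "compose (topspace (cut_space M1)) (cut_map M2 M3 \<psi>2) (cut_map M1 M2 \<psi>1)
      \<in> topspace (cut_space M1) \<rightarrow>\<^sub>E topspace (cut_space M3)"
    using fun1 fun2 by (auto simp: compose_def)
  fix x assume x: "x \<in> topspace (mtop M1)"
  then have "cut_proj M1 x \<in> topspace (cut_space M1)"
    by (rule cut_proj_in_cut_space)
  \<comment> \<open>This lets the square for \<open>\<psi>2\<close> be pasted onto the one for
    \<open>\<psi>1\<close>, at the point \<open>\<psi>1 x\<close>.\<close>
  moreover have "\<psi>1 x \<in> topspace (mtop M2)"
    using equivariant_transverse_in_topspace[OF assms(7) x] .
  ultimately show "compose (topspace (cut_space M1)) (cut_map M2 M3 \<psi>2) (cut_map M1 M2 \<psi>1)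
      (cut_proj M1 x) = cut_proj M3 ((\<psi>2 \<circ> \<psi>1) x)"
    using x cut_map_cut_proj[OF assms(4,7)] cut_map_cut_proj[OF assms(6,8)]
    by (simp add: compose_def)
qed

end
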